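(* Let $k$ be a positive integer and let $G=(V,E)$ be a finite, simple, connected graph on $n=n(G)$ vertices with minimum degree $\delta$ and maximum degree $\Delta\ge k+1$. (i) If $\delta<\Delta=k+1$, then $F_k(G)=1$. (ii) If $\delta=\Delta=k+1$, then $F_k(G)=2$. (iii) If $\Delta\ge k+2$, then \[ F_k(G)\le \frac{(\Delta-k-1)\,n+\max\{\delta(k+1-\Delta)+k,\ k(\delta-\Delta+2)\}}{\Delta-1}. \]
   Context: All graphs are finite, simple and undirected. For a positive integer $k$, a set $S\subseteq V$ is a $k$-forcing set of $G$ if the following process colors every vertex of $G$: initially the vertices of $S$ are colored and all others are uncolored; repeatedly, whenever a colored vertex has at most $k$ uncolored neighbors, all of its uncolored neighbors become colored. The $k$-forcing number $F_k(G)$ is the minimum cardinality of a $k$-forcing set of $G$. *)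

theory Defs
  imports Complex_Main
begin

definition simple_graph :: "'a set \<Rightarrow> ('a \<Rightarrow> 'a \<Rightarrow> bool) \<Rightarrow> bool" where
  "simple_graph V E \<longleftrightarrow> finite V \<and> (\<forall>u v. E u v \<longrightarrow> u \<in> V \<and> v \<in> V)
     \<and> (\<forall>u v. E u v \<longrightarrow> E v u) \<and> (\<forall>v. \<not> E v v)"

definition neighbors :: "'a set \<Rightarrow> ('a \<Rightarrow> 'a \<Rightarrow> bool) \<Rightarrow> 'a \<Rightarrow> 'a set" where
  "neighbors V E v = {u \<in> V. E v u}"

definition degree :: "'a set \<Rightarrow> ('a \<Rightarrow> 'a \<Rightarrow> bool) \<Rightarrow> 'a \<Rightarrow> nat" where
  "degree V E v = card (neighbors V E v)"

definition min_degree :: "'a set \<Rightarrow> ('a \<Rightarrow> 'a \<Rightarrow> bool) \<Rightarrow> nat" where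
  "min_degree V E = Min (degree V E ` V)"

definition max_degree :: "'a set \<Rightarrow> ('a \<Rightarrow> 'a \<Rightarrow> bool) \<Rightarrow> nat" where
  "max_degree V E = Max (degree V E ` V)"

definition connected_graph :: "'a set \<Rightarrow> ('a \<Rightarrow> 'a \<Rightarrow> bool) \<Rightarrow> bool" where
  "connected_graph V E \<longleftrightarrow> V \<noteq> {} \<and> (\<forall>u\<in>V. \<forall>v\<in>V. E\<^sup>*\<^sup>* u v)"

definition kforce_step :: "nat \<Rightarrow> 'a set \<Rightarrow> ('a \<Rightarrow> 'a \<Rightarrow> bool) \<Rightarrow> 'a set \<Rightarrow> 'a set" where
  "kforce_step k V E C = C \<union>
     \<Union> {neighbors V E v | v. v \<in> C \<and> card (neighbors V E v - C) \<le> k}"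

definition is_kforcing_set :: "nat \<Rightarrow> 'a set \<Rightarrow> ('a \<Rightarrow> 'a \<Rightarrow> bool) \<Rightarrow> 'a set \<Rightarrow> bool" where
  "is_kforcing_set k V E S \<longleftrightarrow> S \<subseteq> V \<and> (\<exists>m. (kforce_step k V E ^^ m) S = V)"

definition kforcing_number :: "nat \<Rightarrow> 'a set \<Rightarrow> ('a \<Rightarrow> 'a \<Rightarrow> bool) \<Rightarrow> nat" where
  "kforcing_number k V E = (LEAST c. \<exists>S. is_kforcing_set k V E S \<and> card S = c)"

end

theory Submission
  imports Defs
begin

text \<open>
  Start with a vertex of minimum degree together with \<open>\<delta> - k\<close> of its neighbors; one step colors its
  closed neighborhood. From then on every colored vertex with an uncolored neighbor also has a
  colored one, hence at most \<open>u \<le> \<Delta> - 1\<close> uncolored neighbors, and adding \<open>u - k\<close> of these to the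
  initial set makes it force the remaining ones. So every extension pays at most
  \<open>(\<Delta> - 1 - k) / (\<Delta> - 1)\<close> initial vertices per newly colored vertex, and connectedness makes the
  extensions exhaust the graph. If \<open>\<Delta> = k + 1\<close>, the extensions are free.
\<close>

section \<open>Monotonicity of the forcing process\<close>

lemma kforce_step_increasing: "C \<subseteq> kforce_step k V E C"
  by (auto simp: kforce_step_def)

lemma kforce_step_subset: "C \<subseteq> V \<Longrightarrow> kforce_step k V E C \<subseteq> V"
  by (auto simp: kforce_step_def neighbors_def)

text \<open>A larger colored set leaves every vertex fewer uncolored neighbors, so whatever forces
  from \<open>C\<close> still forces from \<open>D\<close>.\<close>

lemma kforce_step_mono:
  assumes "finite V" "C \<subseteq> D"
  shows "kforce_step k V E C \<subseteq> kforce_step k V E D"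
proof -
  have "card (neighbors V E v - D) \<le> card (neighbors V E v - C)" for v
    by (rule card_mono) (use assms in \<open>auto simp: neighbors_def\<close>)
  then show ?thesis
    using assms(2) unfolding kforce_step_def by (fastforce intro: order_trans)
qed

lemma kforce_step_forces:
  assumes "w \<in> C" "card (neighbors V E w - C) \<le> k"
  shows "neighbors V E w \<subseteq> kforce_step k V E C"
  using assms by (auto simp: kforce_step_def)

lemma funpow_kforce_step_increasing: "C \<subseteq> (kforce_step k V E ^^ m) C"
  by (induction m) (use kforce_step_increasing in fastforce)+

lemma funpow_kforce_step_subset: "C \<subseteq> V \<Longrightarrow> (kforce_step k V E ^^ m) C \<subseteq> V"
  by (induction m) (simp_all add: kforce_step_subset)

lemma funpow_kforce_step_mono:
  "finite V \<Longrightarrow> C \<subseteq> D \<Longrightarrow> (kforce_step k V E ^^ m) C \<subseteq> (kforce_step k V E ^^ m) D"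
  by (induction m) (simp_all add: kforce_step_mono)

section \<open>Growing the colored set across its boundary\<close>

lemma connected_graph_boundary_edge:
  assumes "connected_graph V E" "C \<subseteq> V" "v \<in> C" "C \<noteq> V"
  obtains w x where "w \<in> C" "x \<notin> C" "E w x"
proof -
  obtain y where y: "y \<in> V" "y \<notin> C"
    using assms by blast
  then have "E\<^sup>*\<^sup>* v y"
    using assms by (auto simp: connected_graph_def)
  then have "y \<in> C \<or> (\<exists>w x. w \<in> C \<and> x \<notin> C \<and> E w x)"
    using \<open>v \<in> C\<close> by (induction rule: rtranclp_induct) auto
  then show thesis
    using y that by blast
qed

text \<open>This bounds the price \<open>u - k\<close> of coloring \<open>u\<close> new vertices by
  the uniform rate \<open>(d - k) / d\<close> per vertex. Expanded, it is
  \<open>k * u \<le> d * k\<close>; for \<open>u < k\<close> truncation makes the left side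
  zero.\<close>

lemma extension_cost:
  fixes d k u :: nat
  assumes "u \<le> d"
  shows "d * (u - k) \<le> (d - k) * u"
proof -
  have "k * u \<le> d * k"
    using assms by (simp add: mult.commute)
  then have "d * u - d * k \<le> d * u - k * u"
    by (rule diff_le_mono2)
  then show ?thesis
    by (simp add: diff_mult_distrib diff_mult_distrib2)
qed

text \<open>The set \<open>C\<close> is the part colored so far. All vertices of \<open>C\<close> other than the center \<open>v\<close> have a
  neighbor in \<open>C\<close>, so that at most \<open>d = \<Delta> - 1\<close> of their neighbors are uncolored.\<close>

lemma kforcing_set_extension:
  assumes graph: "simple_graph V E" and conn: "connected_graph V E"
    and deg: "\<And>w. w \<in> V \<Longrightarrow> degree V E w \<le> d + 1"
    and "v \<in> C" "neighbors V E v \<subseteq> C" "C \<subseteq> V"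
    and "\<And>w. w \<in> C \<Longrightarrow> w \<noteq> v \<Longrightarrow> \<exists>x\<in>C. E w x"
    and "S \<subseteq> V" "C \<subseteq> (kforce_step k V E ^^ m) S"
    and "d * card S + b \<le> a + (d - k) * card C"
  shows "\<exists>S. is_kforcing_set k V E S \<and> d * card S + b \<le> a + (d - k) * card V"
  using assms(4-)
\<comment> \<open>The cost inequality is the invariant. The offsets \<open>a\<close> and
  \<open>b\<close> keep the initial balance on both sides, avoiding subtraction of naturals.\<close>
proof (induction "card (V - C)" arbitrary: C S m rule: less_induct)
  case less
  have finV: "finite V" and sym: "\<And>x y. E x y \<Longrightarrow> E y x"
    and inV: "\<And>x y. E x y \<Longrightarrow> x \<in> V \<and> y \<in> V"
    using graph by (auto simp: simple_graph_def)
  show ?case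
  proof (cases "C = V")
    case True
    then have "(kforce_step k V E ^^ m) S = V"
      using less.prems funpow_kforce_step_subset by blast
    then show ?thesis
      using less.prems True by (auto simp: is_kforcing_set_def)
  next
    case False
    obtain w x where wx: "w \<in> C" "x \<notin> C" "E w x"
      using connected_graph_boundary_edge[OF conn \<open>C \<subseteq> V\<close> \<open>v \<in> C\<close> False] by blast
    define U where "U = neighbors V E w - C"
    have U: "x \<in> U" "finite U" "U \<inter> C = {}" "U \<subseteq> V" "neighbors V E w \<subseteq> C \<union> U"
      using wx inV finV by (auto simp: U_def neighbors_def)
    have "w \<noteq> v"
      using wx less.prems(2) inV by (auto simp: neighbors_def)
    then obtain y where y: "y \<in> C" "E w y"
      using less.prems(4) wx by blast
    \<comment> \<open>The colored neighbor \<open>y\<close> uses up one of the at most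
      \<open>d + 1\<close> neighbors of \<open>w\<close>, which leaves at most \<open>d\<close> for
      \<open>U\<close>.\<close>
    have "insert y U \<subseteq> neighbors V E w"
      using y inV by (auto simp: U_def neighbors_def)
    then have "card (insert y U) \<le> degree V E w"
      unfolding degree_def using finV by (intro card_mono) (auto simp: neighbors_def)
    moreover have "y \<notin> U"
      using y U by auto
    ultimately have cardU: "card U \<le> d"
      using deg[of w] wx less.prems(3) U(2) by auto
    \<comment> \<open>If \<open>card U \<le> k\<close>, then \<open>T\<close> is empty and the
      extension costs nothing.\<close>
    obtain T where T: "T \<subseteq> U" "card T = card U - k"
      using obtain_subset_with_card_n[of "card U - k" U] by auto
    define S' where "S' = S \<union> T"
    have CT: "C \<union> T \<subseteq> (kforce_step k V E ^^ m) S'"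
      using less.prems(6) funpow_kforce_step_mono[OF finV, where C = S and D = S' and k = k and E = E and m = m]
        funpow_kforce_step_increasing[where C = S' and k = k and V = V and E = E and m = m] by (auto simp: S'_def)
    have "neighbors V E w - (C \<union> T) = U - T"
      by (auto simp: U_def)
    moreover have "card (U - T) \<le> k"
      using T U(2) by (simp add: card_Diff_subset finite_subset)
    ultimately have "neighbors V E w \<subseteq> kforce_step k V E (C \<union> T)"
      using wx by (intro kforce_step_forces) auto
    then have "C \<union> U \<subseteq> kforce_step k V E (C \<union> T)"
      using kforce_step_increasing[of "C \<union> T" k V E] by (auto simp: U_def)
    then have forced: "C \<union> U \<subseteq> (kforce_step k V E ^^ Suc m) S'"
      using kforce_step_mono[OF finV CT, of k E] by auto
    have "d * card S' \<le> d * card S + d * (card U - k)"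
      using card_Un_le[of S T] T by (metis S'_def add_mult_distrib2 mult_le_mono2)
    also have "\<dots> \<le> d * card S + (d - k) * card U"
      using extension_cost[OF cardU] by simp
    finally have "d * card S' + b \<le> a + (d - k) * card (C \<union> U)"
      using less.prems(7) U card_Un_disjoint[of C U] finite_subset[OF less.prems(3) finV]
      by (simp add: Int_commute add_mult_distrib2)
    moreover have "V - (C \<union> U) \<subset> V - C"
      using U by auto
    then have "card (V - (C \<union> U)) < card (V - C)"
      using finV by (intro psubset_card_mono) auto
    \<comment> \<open>Each new vertex is adjacent to \<open>w\<close>, which lies in
      \<open>C\<close>.\<close>
    moreover have "\<exists>x\<in>C \<union> U. E z x" if "z \<in> C \<union> U" "z \<noteq> v" for z
      using that less.prems(4)[of z] wx(1) sym unfolding U_def neighbors_def by blast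
    moreover have "v \<in> C \<union> U" "neighbors V E v \<subseteq> C \<union> U" "C \<union> U \<subseteq> V" "S' \<subseteq> V"
      using less.prems(1-3,5) U T by (auto simp: S'_def)
    ultimately show ?thesis
      using less.hyps[of "C \<union> U" S' "Suc m"] forced by blast
  qed
qed

text \<open>Truncated subtraction in \<open>degree V E v - k\<close> covers the case where \<open>v\<close> forces all of its
  neighbors alone.\<close>

lemma greedy_kforcing_set:
  assumes graph: "simple_graph V E" and conn: "connected_graph V E" and v: "v \<in> V"
    and deg: "\<And>w. w \<in> V \<Longrightarrow> degree V E w \<le> d + 1"
  shows "\<exists>S. is_kforcing_set k V E S \<and>
    d * card S + (d - k) * (degree V E v + 1) \<le> d * (1 + (degree V E v - k)) + (d - k) * card V"
proof -
  let ?N = "neighbors V E v"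
  have finV: "finite V" and sym: "\<And>x y. E x y \<Longrightarrow> E y x" and irrefl: "\<not> E v v"
    using graph by (auto simp: simple_graph_def)
  have N: "finite ?N" "?N \<subseteq> V" "v \<notin> ?N"
    using finV irrefl by (auto simp: neighbors_def)
  obtain T where T: "T \<subseteq> ?N" "card T = degree V E v - k" "finite T"
    using obtain_subset_with_card_n[of "degree V E v - k" ?N] by (auto simp: degree_def)
  have "?N - insert v T = ?N - T"
    using N by auto
  then have "card (?N - insert v T) \<le> k"
    using T by (simp add: card_Diff_subset degree_def)
  then have "?N \<subseteq> kforce_step k V E (insert v T)"
    by (intro kforce_step_forces) auto
  then have forced: "insert v ?N \<subseteq> (kforce_step k V E ^^ 1) (insert v T)"
    using kforce_step_increasing[of "insert v T" k V E] by auto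
  have "card (insert v T) = 1 + (degree V E v - k)"
    using T N by (subst card_insert_disjoint) auto
  moreover have "card (insert v ?N) = degree V E v + 1"
    using N by (simp add: degree_def)
  \<comment> \<open>The offsets are chosen so that the invariant starts with equality at the closed
    neighborhood of \<open>v\<close>.\<close>
  ultimately have cost: "d * card (insert v T) + (d - k) * (degree V E v + 1)
      \<le> d * (1 + (degree V E v - k)) + (d - k) * card (insert v ?N)"
    by simp
  have nbr: "\<exists>x\<in>insert v ?N. E w x" if "w \<in> insert v ?N" "w \<noteq> v" for w
    using that sym by (auto simp: neighbors_def)
  have sub: "insert v ?N \<subseteq> V" "insert v T \<subseteq> V"
    using v N T by auto
  show ?thesis
    by (rule kforcing_set_extension[OF graph conn deg _ _ sub(1) nbr sub(2) forced cost])
      auto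
qed

section \<open>Lower bounds on the size of a forcing set\<close>

lemma kforcing_number_le: "is_kforcing_set k V E S \<Longrightarrow> kforcing_number k V E \<le> card S"
  unfolding kforcing_number_def by (rule Least_le) auto

lemma kforcing_number_attained:
  assumes "is_kforcing_set k V E S"
  obtains S' where "is_kforcing_set k V E S'" "card S' = kforcing_number k V E"
  using LeastI_ex[of "\<lambda>c. \<exists>S. is_kforcing_set k V E S \<and> card S = c"] assms that
  unfolding kforcing_number_def by blast

lemma is_kforcing_set_stable:
  assumes "is_kforcing_set k V E S" "kforce_step k V E S = S"
  shows "S = V"
proof -
  have "(kforce_step k V E ^^ m) S = S" for m
    by (induction m) (simp_all add: assms(2))
  then show ?thesis
    using assms(1) by (auto simp: is_kforcing_set_def)
qed

lemma kforcing_set_card_pos: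
  assumes "is_kforcing_set k V E S" "finite V" "V \<noteq> {}"
  shows "1 \<le> card S"
proof -
  have "S \<noteq> {}"
    using is_kforcing_set_stable[OF assms(1)] assms(3) by (auto simp: kforce_step_def)
  then show ?thesis
    using assms finite_subset[of S V] by (auto simp: is_kforcing_set_def Suc_le_eq card_gt_0_iff)
qed

text \<open>A lone colored vertex has more than \<open>k\<close> uncolored neighbors, so the process
  stalls at once, before those neighbors are colored.\<close>

lemma kforcing_set_not_singleton:
  assumes graph: "simple_graph V E" and deg: "\<And>w. w \<in> V \<Longrightarrow> k + 1 \<le> degree V E w"
    and S: "is_kforcing_set k V E S"
  shows "card S \<noteq> 1"
proof
  assume "card S = 1"
  then obtain s where s: "S = {s}"
    by (auto simp: card_1_singleton_iff)
  have "s \<in> V"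
    using S s by (auto simp: is_kforcing_set_def)
  have "neighbors V E s - {s} = neighbors V E s"
    using graph by (auto simp: neighbors_def simple_graph_def)
  then have "k < card (neighbors V E s - {s})"
    using deg[OF \<open>s \<in> V\<close>] by (simp add: degree_def)
  then have "kforce_step k V E S = S"
    by (auto simp: kforce_step_def s)
  then have "V = {s}"
    using is_kforcing_set_stable[OF S] s by simp
  then have "neighbors V E s - {s} = {}"
    by (auto simp: neighbors_def)
  then show False
    using \<open>k < card (neighbors V E s - {s})\<close> by (simp only: card.empty)
qed

theorem theorem1:
  fixes k :: nat and V :: "'a set" and E :: "'a \<Rightarrow> 'a \<Rightarrow> bool"
  assumes "k \<ge> 1"
    and "simple_graph V E"
    and "connected_graph V E"
    and "max_degree V E \<ge> k + 1"
  shows "(min_degree V E < max_degree V E \<and> max_degree V E = k + 1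
            \<longrightarrow> kforcing_number k V E = 1)
       \<and> (min_degree V E = k + 1 \<and> max_degree V E = k + 1
            \<longrightarrow> kforcing_number k V E = 2)
       \<and> (max_degree V E \<ge> k + 2 \<longrightarrow>
            real (kforcing_number k V E) \<le>
              ((real (max_degree V E) - real k - 1) * real (card V)
               + max (real (min_degree V E) * (real k + 1 - real (max_degree V E)) + real k)
                     (real k * (real (min_degree V E) - real (max_degree V E) + 2)))
              / (real (max_degree V E) - 1))"
proof -
  define \<delta> where "\<delta> = min_degree V E"
  define d where "d = max_degree V E - 1"
  define F where "F = kforcing_number k V E"
  have max: "max_degree V E = d + 1" and kd: "k \<le> d"
    using assms(4) by (auto simp: d_def)
  have fin: "finite V" and ne: "V \<noteq> {}"
    using assms by (auto simp: simple_graph_def connected_graph_def)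
  have "\<delta> \<in> degree V E ` V"
    unfolding \<delta>_def min_degree_def using fin ne by (intro Min_in) auto
  then obtain v where v: "v \<in> V" "degree V E v = \<delta>"
    by auto
  have ge: "\<delta> \<le> degree V E w" if "w \<in> V" for w
    unfolding \<delta>_def min_degree_def using fin that by (intro Min_le) auto
  have le: "degree V E w \<le> d + 1" if "w \<in> V" for w
    unfolding max[symmetric] max_degree_def using fin that by (intro Max_ge) auto
  obtain S where S: "is_kforcing_set k V E S"
    and cost: "d * card S + (d - k) * (\<delta> + 1) \<le> d * (1 + (\<delta> - k)) + (d - k) * card V"
    using greedy_kforcing_set[OF assms(2,3) v(1) le] v(2) by auto
  obtain S' where S': "is_kforcing_set k V E S'" "card S' = F"
    using kforcing_number_attained[OF S] unfolding F_def by blast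
  have F_pos: "1 \<le> F"
    using kforcing_set_card_pos[OF S'(1) fin ne] S'(2) by simp
  have F_le: "F \<le> card S"
    unfolding F_def by (rule kforcing_number_le[OF S])
  \<comment> \<open>The factor \<open>d - k\<close> vanishes, so only the start at \<open>v\<close>
    is paid for; \<open>k \<ge> 1\<close> allows cancelling \<open>k\<close>.\<close>
  have F_free: "F \<le> 1 + (\<delta> - k)" if "d = k"
  proof -
    have "k * card S \<le> k * (1 + (\<delta> - k))"
      using cost that by simp
    then show ?thesis
      using F_le \<open>k \<ge> 1\<close> by (simp del: mult_Suc_right add_mult_distrib2)
  qed
  have i: "F = 1" if "\<delta> < d + 1" "d = k"
    using F_free F_pos that by simp
  have ii: "F = 2" if "\<delta> = k + 1" "d = k"
  proof -
    have "F \<noteq> 1"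
      using kforcing_set_not_singleton[OF assms(2) _ S'(1)] ge S'(2) that by auto
    then show ?thesis
      using F_free F_pos that by simp
  qed
  have iii: "real F \<le> ((real d - real k) * real (card V)
      + max (real \<delta> * (real k - real d) + real k) (real k * (real \<delta> - real d + 1))) / real d"
    (is "_ \<le> (_ + max ?A ?B) / _")
  proof -
    have "real (d * card S + (d - k) * (\<delta> + 1)) \<le> real (d * (1 + (\<delta> - k)) + (d - k) * card V)"
      using cost by (simp only: of_nat_le_iff)
    \<comment> \<open>Since \<open>k \<le> d\<close>, the difference \<open>d - k\<close> passes to
      the reals; \<open>\<delta> - k\<close> stays truncated until the case split.\<close>
    then have cost': "real d * real (card S) + (real d - real k) * (real \<delta> + 1)
        \<le> real d * (1 + real (\<delta> - k)) + (real d - real k) * real (card V)"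
      using kd by (simp only: of_nat_add of_nat_mult of_nat_diff of_nat_1)
    \<comment> \<open>The two terms of the maximum are the values of the left side with
      \<open>\<delta> - k\<close> truncated to zero (\<open>?A\<close>) and as a true difference
      (\<open>?B\<close>).\<close>
    have "real d * (1 + real (\<delta> - k)) - (real d - real k) * (real \<delta> + 1) \<le> max ?A ?B"
    proof (cases "k \<le> \<delta>")
      case True
      then have "real d * (1 + real (\<delta> - k)) - (real d - real k) * (real \<delta> + 1) = ?B"
        by (simp add: of_nat_diff algebra_simps)
      then show ?thesis by simp
    next
      case False
      then have "real d * (1 + real (\<delta> - k)) - (real d - real k) * (real \<delta> + 1) = ?A"
        by (simp add: algebra_simps)
      then show ?thesis by simp
    qed
    moreover have "real d * real F \<le> real d * real (card S)"
      using F_le by (intro mult_left_mono) auto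
    ultimately have "real F * real d \<le> (real d - real k) * real (card V) + max ?A ?B"
      using cost' by (simp only: mult.commute[of "real F"])
    moreover have "0 < real d"
      using kd \<open>k \<ge> 1\<close> by simp
    ultimately show ?thesis
      by (simp add: pos_le_divide_eq)
  qed
  show ?thesis
    unfolding max F_def[symmetric] \<delta>_def[symmetric]
    using i ii iii by (simp add: algebra_simps)
qed

end
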